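(* Let $U, V, W$ be vector spaces over a field $F$, let $T_1 \colon V \to W$ and $T_2 \colon U \to V$ be linear, and let $G_1 \in \operatorname{I}(T_1, B_1, E_1)$ and $G_2 \in \operatorname{I}(T_2, B_2, E_2)$ be inner inverses of $T_1$ and $T_2$, respectively. The following conditions are equivalent: (i) $G_2G_1$ is an inner inverse of $T_1T_2$. (ii) $B_1 \cap (\operatorname{Im} T_2 + \operatorname{Ker} T_1) \leq \operatorname{Im} T_2 \oplus (\operatorname{Ker} T_1 \cap E_2)$. (iii) $\operatorname{Im} T_2 \leq B_1 \oplus (\operatorname{Ker} T_1 \cap \operatorname{Im} T_2) \oplus (\operatorname{Ker} T_1 \cap E_2)$. (iv) $E_2 \oplus (\operatorname{Ker} T_1 \cap \operatorname{Im} T_2) \geq \operatorname{Ker} T_1 \cap (\operatorname{Im} T_2 + B_1)$. (v) $\operatorname{Ker} T_1 \geq E_2 \cap (\operatorname{Im} T_2 + \operatorname{Ker} T_1) \cap (\operatorname{Im} T_2 + B_1)$.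
   Context: Vector spaces are arbitrary (possibly infinite-dimensional). For a linear map $T\colon V\to W$, a linear map $G\colon W\to V$ is called an inner inverse of $T$ if $TGT=T$. For subspaces $B\leq V$ and $E\leq W$ with $V=\operatorname{Ker} T\oplus B$ and $W=\operatorname{Im} T\oplus E$, one writes $G\in \operatorname{I}(T,B,E)$ if $G$ is an inner inverse of $T$ with $\operatorname{Im} GT = B$ and $\operatorname{Ker} TG = E$. For subspaces, $\leq$ (and $\geq$) denotes inclusion, and $\oplus$ denotes a sum of subspaces that is direct. *)

theory Defs
  imports Complex_Main "HOL-Library.Set_Algebras"
begin

text \<open>
  Each vector space is a whole type together with a scalar multiplication satisfying
  \<^locale>\<open>vector_space\<close>. Images are written with \<^const>\<open>range\<close>, and \<open>A + B\<close> for sets is the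
  pointwise sum of \<open>HOL-Library.Set_Algebras\<close>, which is the usual sum when \<open>A\<close> and \<open>B\<close> are
  subspaces.
\<close>

definition Ker :: "('a \<Rightarrow> 'b::zero) \<Rightarrow> 'a set" where
  "Ker T = {x. T x = 0}"

text \<open>
  For subspaces, \<open>A \<oplus> B\<close> is the set \<open>A + B\<close> together with the claim \<open>direct A B\<close>.
  A triple sum \<open>A \<oplus> B \<oplus> C\<close> carries the claims \<open>direct A B\<close> and \<open>direct (A + B) C\<close>.
\<close>

definition direct :: "'a::zero set \<Rightarrow> 'a set \<Rightarrow> bool" where
  "direct A B \<longleftrightarrow> A \<inter> B = {0}"

definition inner_inverse ::
  "('f::field \<Rightarrow> 'v::ab_group_add \<Rightarrow> 'v) \<Rightarrow> ('f \<Rightarrow> 'w::ab_group_add \<Rightarrow> 'w) \<Rightarrow>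
    ('v \<Rightarrow> 'w) \<Rightarrow> ('w \<Rightarrow> 'v) \<Rightarrow> bool" where
  "inner_inverse sV sW T G \<longleftrightarrow> Vector_Spaces.linear sW sV G \<and> T \<circ> G \<circ> T = T"

text \<open>
  The set \<open>I(T, B, E)\<close> is only meaningful when \<open>B\<close> complements the kernel and \<open>E\<close> the image
  of \<open>T\<close>; membership includes these side conditions.
\<close>

definition inner_inverses ::
  "('f::field \<Rightarrow> 'v::ab_group_add \<Rightarrow> 'v) \<Rightarrow> ('f \<Rightarrow> 'w::ab_group_add \<Rightarrow> 'w) \<Rightarrow>
    ('v \<Rightarrow> 'w) \<Rightarrow> 'v set \<Rightarrow> 'w set \<Rightarrow> ('w \<Rightarrow> 'v) set" where
  "inner_inverses sV sW T B E =
    {G. module.subspace sV B \<and> Ker T + B = UNIV \<and> direct (Ker T) B \<and>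
        module.subspace sW E \<and> range T + E = UNIV \<and> direct (range T) E \<and>
        inner_inverse sV sW T G \<and> range (G \<circ> T) = B \<and> Ker (T \<circ> G) = E}"

end

theory Submission
  imports Defs
begin

text \<open>
  The maps \<open>P = G1 \<circ> T1\<close> and \<open>Q = T2 \<circ> G2\<close> are additive idempotents of \<open>V\<close>: \<open>P\<close> projects onto \<open>B1\<close>
  along \<open>Ker T1\<close> and \<open>Q\<close> projects onto \<open>range T2\<close> along \<open>E2\<close>. Since \<open>P x - x \<in> Ker T1\<close>,
  condition (i) says that \<open>b - Q b \<in> Ker T1\<close> for all \<open>b\<close> in
  \<open>P (range T2) = B1 \<inter> (range T2 + Ker T1)\<close>. Each of the conditions (ii)--(v) is a reformulation
  of this, because \<open>b - Q b\<close> is the \<open>E2\<close>-component of \<open>b\<close> with respect to \<open>range T2 \<oplus> E2\<close>.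
\<close>

lemma Ker_iff: "x \<in> Ker T \<longleftrightarrow> T x = 0"
  by (simp add: Ker_def)

text \<open>Conditions (ii)-(v) involve only four subspaces of one space: \<open>B1\<close>,
  \<open>Ker T1\<close>, \<open>range T2\<close>, \<open>E2\<close>. They become the ranges and
  kernels of two idempotents, so the equivalences can be proved by computing with \<open>P\<close>
  and \<open>Q\<close> alone.\<close>

locale idempotent_pair = P: additive P + Q: additive Q
  for P Q :: "'v::ab_group_add \<Rightarrow> 'v" +
  assumes P_idem: "P (P x) = P x" and Q_idem: "Q (Q x) = Q x"
begin

lemma range_P_iff: "x \<in> range P \<longleftrightarrow> P x = x"
  by (metis P_idem rangeE rangeI)

lemma range_Q_iff: "x \<in> range Q \<longleftrightarrow> Q x = x"
  by (metis Q_idem rangeE rangeI)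

lemmas mem_iffs = range_P_iff range_Q_iff Ker_iff
lemmas additive_simps =
  P.add P.diff P.minus P.zero Q.add Q.diff Q.minus Q.zero P_idem Q_idem

lemma direct_range_Q_Ker: "direct (range Q) (Ker P \<inter> Ker Q)"
  unfolding direct_def set_eq_iff Int_iff mem_iffs singleton_iff by (metis P.zero Q.zero)

lemma direct_range_P_Ker: "direct (range P) (Ker P \<inter> range Q)"
  unfolding direct_def set_eq_iff Int_iff mem_iffs singleton_iff by (metis P.zero Q.zero)

text \<open>\<open>P\<close> recovers the \<open>range P\<close> part of a vector of the first
  summand. If the vector is also in \<open>Ker P\<close>, this part is 0, and what remains lies in
  both \<open>range Q\<close> and \<open>Ker Q\<close>.\<close>

lemma direct_triple: "direct (range P + (Ker P \<inter> range Q)) (Ker P \<inter> Ker Q)"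
proof -
  have "x = 0" if "x \<in> range P + (Ker P \<inter> range Q)" and e: "x \<in> Ker P \<inter> Ker Q" for x
  proof -
    from that(1) obtain b k where bk: "x = b + k" "b \<in> range P" "k \<in> Ker P \<inter> range Q"
      by (blast elim: set_plus_elim)
    have "P x = b" unfolding bk(1) using bk(2,3) by (simp add: mem_iffs additive_simps)
    with e have "b = 0" by (simp add: Ker_iff)
    with bk have "Q x = x" by (simp add: mem_iffs)
    with e show ?thesis by (simp add: Ker_iff)
  qed
  moreover have "0 + 0 \<in> range P + (Ker P \<inter> range Q)"
    by (intro set_plus_intro) (simp_all add: mem_iffs additive_simps)
  ultimately show ?thesis by (auto simp: direct_def Ker_iff additive_simps)
qed

lemma direct_Ker_Q_Ker: "direct (Ker Q) (Ker P \<inter> range Q)"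
  unfolding direct_def set_eq_iff Int_iff mem_iffs singleton_iff by (metis P.zero Q.zero)

text \<open>Condition (i) in terms of \<open>P\<close> and \<open>Q\<close>. The residual
  \<open>P x - Q (P x)\<close> is the \<open>Ker Q\<close> component of \<open>P x\<close>.\<close>

definition residual_vanishes :: bool where
  "residual_vanishes \<longleftrightarrow> (\<forall>x\<in>range Q. P x - Q (P x) \<in> Ker P)"

lemma residual_vanishesD:
  "residual_vanishes \<Longrightarrow> x \<in> range Q \<Longrightarrow> P x - Q (P x) \<in> Ker P"
  unfolding residual_vanishes_def by (rule bspec)

lemma residual_vanishes_iff:
  "residual_vanishes \<longleftrightarrow> (\<forall>b \<in> range P \<inter> (range Q + Ker P). b - Q b \<in> Ker P)"
proof -
  have image: "P ` range Q = range P \<inter> (range Q + Ker P)"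
  proof (intro equalityI subsetI)
    fix b assume "b \<in> P ` range Q"
    then obtain x where x: "x \<in> range Q" "b = P x" by blast
    have "P x - x \<in> Ker P" by (simp add: Ker_iff additive_simps)
    from set_plus_intro[OF x(1) this] x show "b \<in> range P \<inter> (range Q + Ker P)" by simp
  next
    fix b assume b: "b \<in> range P \<inter> (range Q + Ker P)"
    then obtain r k where rk: "b = r + k" "r \<in> range Q" "k \<in> Ker P"
      by (auto elim: set_plus_elim)
    then have "P b = P r" by (simp add: Ker_iff additive_simps)
    with b have "b = P r" by (simp add: range_P_iff)
    with rk show "b \<in> P ` range Q" by blast
  qed
  show ?thesis
    unfolding residual_vanishes_def image[symmetric] by blast
qed

text \<open>The \<open>Ker Q\<close> component of \<open>b\<close> is unique and equals
  \<open>b - Q b\<close>, so \<open>b\<close> lies in the right-hand sum iff this component lies in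
  \<open>Ker P\<close>.\<close>

lemma residual_vanishes_iff_ii:
  "residual_vanishes \<longleftrightarrow> range P \<inter> (range Q + Ker P) \<subseteq> range Q + (Ker P \<inter> Ker Q)"
proof -
  have "b - Q b \<in> Ker P \<longleftrightarrow> b \<in> range Q + (Ker P \<inter> Ker Q)" for b
  proof
    assume "b - Q b \<in> Ker P"
    then have "b - Q b \<in> Ker P \<inter> Ker Q" by (simp add: Ker_iff additive_simps)
    from set_plus_intro[OF rangeI[of Q b] this] show "b \<in> range Q + (Ker P \<inter> Ker Q)" by simp
  next
    assume "b \<in> range Q + (Ker P \<inter> Ker Q)"
    then obtain r e where "b = r + e" "r \<in> range Q" "e \<in> Ker P \<inter> Ker Q"
      by (blast elim: set_plus_elim)
    then show "b - Q b \<in> Ker P" by (simp add: mem_iffs additive_simps)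
  qed
  then show ?thesis unfolding residual_vanishes_iff by blast
qed

lemma residual_vanishes_iff_iii:
  "residual_vanishes \<longleftrightarrow> range Q \<subseteq> range P + (Ker P \<inter> range Q) + (Ker P \<inter> Ker Q)"
proof
  assume vanish: residual_vanishes
  show "range Q \<subseteq> range P + (Ker P \<inter> range Q) + (Ker P \<inter> Ker Q)"
  proof
    fix x assume x: "x \<in> range Q"
    with vanish have "P x - Q (P x) \<in> Ker P" by (rule residual_vanishesD)
    \<comment> \<open>Here \<open>x - Q (P x)\<close> is the sum of \<open>x - P x\<close>, always
      in \<open>Ker P\<close>, and the residual.\<close>
    with x have "x - Q (P x) \<in> Ker P \<inter> range Q" "Q (P x) - P x \<in> Ker P \<inter> Ker Q"
      by (simp_all add: mem_iffs additive_simps)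
    then have "P x + (x - Q (P x)) + (Q (P x) - P x)
        \<in> range P + (Ker P \<inter> range Q) + (Ker P \<inter> Ker Q)"
      by (intro set_plus_intro rangeI)
    then show "x \<in> range P + (Ker P \<inter> range Q) + (Ker P \<inter> Ker Q)" by simp
  qed
next
  assume incl: "range Q \<subseteq> range P + (Ker P \<inter> range Q) + (Ker P \<inter> Ker Q)"
  show residual_vanishes
    unfolding residual_vanishes_def
  proof
    fix x assume x: "x \<in> range Q"
    with incl obtain b k e where xs: "x = b + k + e" "b \<in> range P"
      and k: "k \<in> Ker P \<inter> range Q" and e: "e \<in> Ker P \<inter> Ker Q"
      by (blast elim: set_plus_elim)
    have Px: "P x = b" using xs k e by (simp add: mem_iffs additive_simps)
    \<comment> \<open>As \<open>x\<close> and \<open>k\<close> are fixed by \<open>Q\<close> and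
      \<open>e\<close> is killed, the residual \<open>b - Q b\<close> comes out as
      \<open>- e\<close>.\<close>
    have "Q b = Q x - Q k - Q e" using xs(1) by (simp add: additive_simps)
    also have "\<dots> = b + e" using x xs k e by (simp add: mem_iffs)
    finally show "P x - Q (P x) \<in> Ker P" using Px e by (simp add: Ker_iff additive_simps)
  qed
qed

text \<open>The left-hand set consists of the vectors \<open>P x - x\<close> with
  \<open>x \<in> range Q\<close>. The \<open>Ker Q\<close> component of such a vector is the
  residual of \<open>x\<close>, and its \<open>range Q\<close> component lies in
  \<open>Ker P\<close> iff the residual does.\<close>

lemma residual_vanishes_iff_iv:
  "residual_vanishes \<longleftrightarrow> Ker P \<inter> (range Q + range P) \<subseteq> Ker Q + (Ker P \<inter> range Q)"
proof
  assume vanish: residual_vanishes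
  show "Ker P \<inter> (range Q + range P) \<subseteq> Ker Q + (Ker P \<inter> range Q)"
  proof
    fix k assume k: "k \<in> Ker P \<inter> (range Q + range P)"
    then obtain r b where rb: "k = r + b" "r \<in> range Q" "b \<in> range P"
      by (auto elim: set_plus_elim)
    have "P b = - P r" using k rb(1) by (simp add: Ker_iff additive_simps add_eq_0_iff)
    then have "P (- r) = b" using rb by (simp add: range_P_iff additive_simps)
    moreover have "- r \<in> range Q" using rb by (simp add: range_Q_iff additive_simps)
    ultimately have "b - Q b \<in> Ker P" using residual_vanishesD[OF vanish, of "- r"] by simp
    \<comment> \<open>Since \<open>Q r = r\<close>, the difference \<open>k - Q k\<close> equals
      \<open>b - Q b\<close>, and \<open>k\<close> itself is in \<open>Ker P\<close>.\<close>
    then have "Q k \<in> Ker P \<inter> range Q" using k rb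
      by (simp add: mem_iffs additive_simps)
    moreover have "k - Q k \<in> Ker Q" by (simp add: Ker_iff additive_simps)
    ultimately have "(k - Q k) + Q k \<in> Ker Q + (Ker P \<inter> range Q)" by (intro set_plus_intro)
    then show "k \<in> Ker Q + (Ker P \<inter> range Q)" by simp
  qed
next
  assume incl: "Ker P \<inter> (range Q + range P) \<subseteq> Ker Q + (Ker P \<inter> range Q)"
  show residual_vanishes
    unfolding residual_vanishes_def
  proof
    fix x assume x: "x \<in> range Q"
    then have "- x \<in> range Q" by (simp add: range_Q_iff additive_simps)
    from set_plus_intro[OF this rangeI[of P x]]
    have "P x - x \<in> Ker P \<inter> (range Q + range P)" by (simp add: Ker_iff additive_simps)
    with incl obtain e r where er: "P x - x = e + r" "e \<in> Ker Q" "r \<in> Ker P \<inter> range Q"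
      by (blast elim: set_plus_elim)
    then have Px: "P x = e + r + x" by (simp add: algebra_simps)
    \<comment> \<open>The vector \<open>e\<close> is the residual of \<open>x\<close>; it is in
      \<open>Ker P\<close> because \<open>P x - x\<close> and \<open>r\<close> are.\<close>
    have "P e = P (P x - x) - P r" unfolding er(1) by (simp add: additive_simps)
    then have "P e = 0" using er(3) by (simp add: mem_iffs additive_simps)
    moreover have "Q (P x) = r + x" using Px er x by (simp add: mem_iffs additive_simps)
    ultimately show "P x - Q (P x) \<in> Ker P" using Px by (simp add: Ker_iff)
  qed
qed

text \<open>The left-hand set is exactly the set of residuals \<open>P x - Q (P x)\<close> with
  \<open>x \<in> range Q\<close>.\<close>

lemma residual_vanishes_iff_v:
  "residual_vanishes \<longleftrightarrow> Ker Q \<inter> (range Q + Ker P) \<inter> (range Q + range P) \<subseteq> Ker P"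
proof
  assume vanish: residual_vanishes
  show "Ker Q \<inter> (range Q + Ker P) \<inter> (range Q + range P) \<subseteq> Ker P"
  proof
    fix e assume e: "e \<in> Ker Q \<inter> (range Q + Ker P) \<inter> (range Q + range P)"
    then have "e \<in> range Q + Ker P" and "e \<in> range Q + range P" by simp_all
    then obtain r k r' b where e1: "e = r + k" "r \<in> range Q" "k \<in> Ker P"
      and e2: "e = r' + b" "r' \<in> range Q" "b \<in> range P"
      by (elim set_plus_elim)
    \<comment> \<open>Comparing the two decompositions of \<open>e\<close> gives
      \<open>r - r' = b - k\<close>, which \<open>P\<close> maps to \<open>b\<close>. So
      \<open>e\<close> is the residual of \<open>r - r'\<close>.\<close>
    have "r = e - k" using e1(1) by simp
    moreover have "r' = e - b" using e2(1) by simp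
    ultimately have "P (r - r') = P (b - k)" by simp
    also have "\<dots> = b" using e1(3) e2(3) by (simp add: mem_iffs additive_simps)
    finally have "P (r - r') = b" .
    moreover have "r - r' \<in> range Q" using e1(2) e2(2) by (simp add: range_Q_iff additive_simps)
    ultimately have "b - Q b \<in> Ker P" using residual_vanishesD[OF vanish, of "r - r'"] by simp
    moreover have "Q b = Q e - Q r'" unfolding e2(1) by (simp add: additive_simps)
    then have "Q b = - r'" using e e2(2) by (simp add: mem_iffs)
    ultimately show "e \<in> Ker P" using e2(1) by (simp add: add.commute)
  qed
next
  assume incl: "Ker Q \<inter> (range Q + Ker P) \<inter> (range Q + range P) \<subseteq> Ker P"
  show residual_vanishes
    unfolding residual_vanishes_def
  proof
    fix x assume x: "x \<in> range Q"
    have "x - Q (P x) \<in> range Q" "P x - x \<in> Ker P"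
      using x by (simp_all add: mem_iffs additive_simps)
    from set_plus_intro[OF this] have "P x - Q (P x) \<in> range Q + Ker P" by simp
    moreover have "- Q (P x) \<in> range Q" by (simp add: range_Q_iff additive_simps)
    from set_plus_intro[OF this rangeI[of P x]] have "P x - Q (P x) \<in> range Q + range P" by simp
    moreover have "P x - Q (P x) \<in> Ker Q" by (simp add: Ker_iff additive_simps)
    ultimately show "P x - Q (P x) \<in> Ker P" using incl by blast
  qed
qed

end

lemma linear_additive: "Vector_Spaces.linear s t f \<Longrightarrow> additive f"
  by (simp add: additive_def linear_iff_module_hom module_hom.add)

theorem theorem11:
  fixes sU :: "'f::field \<Rightarrow> 'u::ab_group_add \<Rightarrow> 'u"
    and sV :: "'f \<Rightarrow> 'v::ab_group_add \<Rightarrow> 'v"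
    and sW :: "'f \<Rightarrow> 'w::ab_group_add \<Rightarrow> 'w"
    and T1 :: "'v \<Rightarrow> 'w" and T2 :: "'u \<Rightarrow> 'v"
    and G1 :: "'w \<Rightarrow> 'v" and G2 :: "'v \<Rightarrow> 'u"
    and B1 :: "'v set" and E1 :: "'w set"
    and B2 :: "'u set" and E2 :: "'v set"
  assumes "vector_space sU" and "vector_space sV" and "vector_space sW"
    and "Vector_Spaces.linear sV sW T1" and "Vector_Spaces.linear sU sV T2"
    and "G1 \<in> inner_inverses sV sW T1 B1 E1"
    and "G2 \<in> inner_inverses sU sV T2 B2 E2"
  shows
    "direct (range T2) (Ker T1 \<inter> E2) \<and>
     direct B1 (Ker T1 \<inter> range T2) \<and>
     direct (B1 + (Ker T1 \<inter> range T2)) (Ker T1 \<inter> E2) \<and>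
     direct E2 (Ker T1 \<inter> range T2) \<and>
     (inner_inverse sU sW (T1 \<circ> T2) (G2 \<circ> G1) \<longleftrightarrow>
        B1 \<inter> (range T2 + Ker T1) \<subseteq> range T2 + (Ker T1 \<inter> E2)) \<and>
     (inner_inverse sU sW (T1 \<circ> T2) (G2 \<circ> G1) \<longleftrightarrow>
        range T2 \<subseteq> B1 + (Ker T1 \<inter> range T2) + (Ker T1 \<inter> E2)) \<and>
     (inner_inverse sU sW (T1 \<circ> T2) (G2 \<circ> G1) \<longleftrightarrow>
        E2 + (Ker T1 \<inter> range T2) \<supseteq> Ker T1 \<inter> (range T2 + B1)) \<and>
     (inner_inverse sU sW (T1 \<circ> T2) (G2 \<circ> G1) \<longleftrightarrow>
        Ker T1 \<supseteq> E2 \<inter> (range T2 + Ker T1) \<inter> (range T2 + B1))"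
proof -
  from assms(6) have lG1: "Vector_Spaces.linear sW sV G1" and TGT1: "T1 \<circ> G1 \<circ> T1 = T1"
    and B1: "range (G1 \<circ> T1) = B1"
    by (auto simp: inner_inverses_def inner_inverse_def)
  from assms(7) have lG2: "Vector_Spaces.linear sV sU G2" and TGT2: "T2 \<circ> G2 \<circ> T2 = T2"
    and E2: "Ker (T2 \<circ> G2) = E2"
    by (auto simp: inner_inverses_def inner_inverse_def)
  note TGT1' = fun_cong[OF TGT1, simplified comp_def]
  note TGT2' = fun_cong[OF TGT2, simplified comp_def]
  interpret T1: additive T1 by (rule linear_additive) fact
  interpret G1: additive G1 by (rule linear_additive) fact
  interpret T2: additive T2 by (rule linear_additive) fact
  interpret G2: additive G2 by (rule linear_additive) fact
  interpret idempotent_pair "G1 \<circ> T1" "T2 \<circ> G2"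
    by unfold_locales (simp_all add: T1.add G1.add T2.add G2.add TGT1' TGT2')
  \<comment> \<open>\<open>G1\<close> is injective on \<open>range T1\<close>, where
    \<open>T1 \<circ> G1\<close> is the identity.\<close>
  have G1_T1_eq_0: "G1 (T1 x) = 0 \<longleftrightarrow> T1 x = 0" for x
    by (metis TGT1' T1.zero G1.zero)
  have K: "Ker (G1 \<circ> T1) = Ker T1"
    by (simp add: set_eq_iff Ker_iff G1_T1_eq_0)
  have R: "range (T2 \<circ> G2) = range T2"
    by (auto simp: image_iff) (metis TGT2')
  have "Vector_Spaces.linear sW sU (G2 \<circ> G1)"
    using lG1 lG2 by (rule Vector_Spaces.linear_compose)
  then have "inner_inverse sU sW (T1 \<circ> T2) (G2 \<circ> G1) \<longleftrightarrow>
      (\<forall>u. T1 (T2 u) = T1 (T2 (G2 (G1 (T1 (T2 u))))))"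
    by (auto simp: inner_inverse_def fun_eq_iff)
  \<comment> \<open>With \<open>x = T2 u\<close>, the left side \<open>T1 x\<close> equals
    \<open>T1 (G1 (T1 x))\<close>, so the equation says that \<open>T1\<close> kills the residual of
    \<open>x\<close>.\<close>
  also have "\<dots> \<longleftrightarrow> residual_vanishes"
    unfolding residual_vanishes_def R K by (simp add: Ker_iff T1.diff TGT1')
  finally have i: "inner_inverse sU sW (T1 \<circ> T2) (G2 \<circ> G1) \<longleftrightarrow> residual_vanishes" .
  show ?thesis
    unfolding i
    using direct_range_Q_Ker direct_range_P_Ker direct_triple direct_Ker_Q_Ker
      residual_vanishes_iff_ii residual_vanishes_iff_iii residual_vanishes_iff_iv
      residual_vanishes_iff_v
    unfolding K R B1 E2 by - (intro conjI; assumption)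
qed

end
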